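(* Let $q$ be an odd prime power and let $n$ be an even positive integer. Then the number of invertible $n\times n$ skew-symmetric matrices over $\mathbf{F}_q$ is equal to the number of invertible $(n-1)\times(n-1)$ symmetric matrices over $\mathbf{F}_q$.
   Context: $\mathbf{F}_q$ is the field with $q$ elements. A matrix $A$ is skew-symmetric if $A^T=-A$ (so, $q$ being odd, its diagonal is zero). *)

theory Defs
  imports "Jordan_Normal_Form.Matrix" "HOL-Number_Theory.Prime_Powers" "HOL-Library.Cardinality"
begin

definition symmetric_mat :: "'a mat \<Rightarrow> bool" where
  "symmetric_mat A \<longleftrightarrow> transpose_mat A = A"

definition skew_symmetric_mat :: "'a :: uminus mat \<Rightarrow> bool" where
  "skew_symmetric_mat A \<longleftrightarrow> transpose_mat A = - A"

end

theory Submission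
  imports Defs "Jordan_Normal_Form.Determinant" "Berlekamp_Zassenhaus.Berlekamp_Type_Based"
begin

text \<open>
  Write $s(n)$ and $a(n)$ for the numbers of invertible symmetric and skew-symmetric matrices of
  size $n$ over a field with $q$ elements. Both counts satisfy recursions, obtained by splitting off
  a small nondegenerate piece of the bilinear form that the matrix describes, and the recursions
  force $a(2k+2) = s(2k+1)$.

  If the corner entry of a symmetric matrix is nonzero, the first basis vector spans a
  nondegenerate line, and the Schur complement is an arbitrary invertible symmetric matrix of size
  one less (\<open>card_sym_nonzero_corner\<close>). If the corner entry is zero, the first column is some
  nonzero vector with vanishing first entry. A congruence that fixes the first basis functional
  moves this column to any other such vector, so all these columns occur equally often
  (\<open>card_fixed_col_congruence\<close>, \<open>exists_pivot_mat\<close>). For the second unit vector as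
  first column, the first two basis vectors span a hyperbolic plane, and its complement contributes
  an invertible matrix of size two less (\<open>card_scaled_sym_unit_col\<close>). The corner entry of a
  skew-symmetric matrix is always zero in odd characteristic. Hence
  $s(m+2) = (q-1) q^{m+1} s(m+1) + (q^{m+1}-1) q^{m+1} s(m)$ and
  $a(m+2) = (q^{m+1}-1) q^m a(m)$.

  The first recursion has order two, but with the auxiliary relation
  $s(2k+1) = (q^{2k+1}-1) s(2k)$ it collapses to $s(2k+2) = q^{2k+2} s(2k+1)$, which then
  reproduces the relation for $k+1$. Two steps of $s$ therefore multiply by
  $(q^{2k+3}-1) q^{2k+2}$, which is exactly one step of $a$ (\<open>sym_skew_recursions_agree\<close>).
\<close>

section \<open>Nonsingular matrices that agree with their transpose up to a scalar\<close>

text \<open>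
  The parameter $e$ is $1$ for symmetric and $-1$ for skew-symmetric matrices, so that the case of
  zero corner entry is treated once for both. Invertibility is expressed by the determinant, which
  can be followed through block decompositions.
\<close>
definition scaled_sym_mats :: "'a :: field \<Rightarrow> nat \<Rightarrow> 'a mat set" where
  "scaled_sym_mats e n = {A \<in> carrier_mat n n. det A \<noteq> 0 \<and> transpose_mat A = e \<cdot>\<^sub>m A}"

lemma transpose_eq_smult_iff:
  assumes "A \<in> carrier_mat n n"
  shows "transpose_mat A = e \<cdot>\<^sub>m A \<longleftrightarrow> (\<forall>i<n. \<forall>j<n. A $$ (j,i) = e * A $$ (i,j))"
proof
  assume eq: "transpose_mat A = e \<cdot>\<^sub>m A"
  show "\<forall>i<n. \<forall>j<n. A $$ (j,i) = e * A $$ (i,j)"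
  proof (intro allI impI)
    fix i j assume ij: "i < n" "j < n"
    then show "A $$ (j,i) = e * A $$ (i,j)"
      using arg_cong[OF eq, of "\<lambda>M. M $$ (i,j)"] assms by simp
  qed
next
  assume eq: "\<forall>i<n. \<forall>j<n. A $$ (j,i) = e * A $$ (i,j)"
  show "transpose_mat A = e \<cdot>\<^sub>m A"
  proof (rule eq_matI)
    fix i j assume "i < dim_row (e \<cdot>\<^sub>m A)" "j < dim_col (e \<cdot>\<^sub>m A)"
    then have ij: "i < n" "j < n" using assms by auto
    then have "A $$ (j,i) = e * A $$ (i,j)" using eq by blast
    then show "transpose_mat A $$ (i,j) = (e \<cdot>\<^sub>m A) $$ (i,j)" using ij assms by simp
  qed (use assms in auto)
qed

lemma det_nonzero_obtains_inverse:
  fixes A :: "'a :: field mat"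
  assumes A: "A \<in> carrier_mat n n" and "det A \<noteq> 0"
  obtains B where "B \<in> carrier_mat n n" and "A * B = 1\<^sub>m n" and "B * A = 1\<^sub>m n"
  using det_non_zero_imp_unit[OF assms, of undefined] by (auto simp: Units_def ring_mat_def)

lemma invertible_mat_iff_det:
  fixes A :: "'a :: field mat"
  assumes A: "A \<in> carrier_mat n n"
  shows "invertible_mat A \<longleftrightarrow> det A \<noteq> 0"
proof
  assume "invertible_mat A"
  then obtain B where B: "A * B = 1\<^sub>m n" "B * A = 1\<^sub>m (dim_row B)"
    using A by (auto simp: invertible_mat_def inverts_mat_def)
  have "dim_col B = n" "dim_row B = n"
    using arg_cong[OF B(1), of dim_col] arg_cong[OF B(2), of dim_col] A by auto
  then have "B \<in> carrier_mat n n" by auto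
  from det_mult[OF A this] B show "det A \<noteq> 0" by auto
next
  assume "det A \<noteq> 0"
  from det_nonzero_obtains_inverse[OF A this] obtain B
    where "B \<in> carrier_mat n n" "A * B = 1\<^sub>m n" "B * A = 1\<^sub>m n" .
  with A show "invertible_mat A" by (auto simp: invertible_mat_def inverts_mat_def)
qed

lemma finite_scaled_sym_mats:
  "finite (scaled_sym_mats (e :: 'a :: {field, finite}) n)"
proof (rule finite_subset)
  show "scaled_sym_mats e n \<subseteq> (\<lambda>f. mat n n f) ` (PiE ({..<n} \<times> {..<n}) (\<lambda>_. UNIV))"
  proof
    fix A assume "A \<in> scaled_sym_mats e n"
    then have "A \<in> carrier_mat n n" by (simp add: scaled_sym_mats_def)
    then have "A = mat n n (restrict (\<lambda>p. A $$ p) ({..<n} \<times> {..<n}))"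
      by (intro eq_matI) auto
    moreover have "restrict (\<lambda>p. A $$ p) ({..<n} \<times> {..<n}) \<in> PiE ({..<n} \<times> {..<n}) (\<lambda>_. UNIV)"
      by auto
    ultimately show "A \<in> (\<lambda>f. mat n n f) ` (PiE ({..<n} \<times> {..<n}) (\<lambda>_. UNIV))"
      by (rule image_eqI)
  qed
qed (intro finite_imageI finite_PiE; simp)

section \<open>Matrices with nonzero corner entry\<close>

text \<open>
  Block elimination: $A$ is the product of a unit lower triangular matrix and a block upper
  triangular matrix whose diagonal blocks are the corner entry and the Schur complement.
\<close>

lemma det_schur_complement:
  fixes A :: "'a :: field mat"
  assumes A: "A \<in> carrier_mat (Suc m) (Suc m)" and a: "A $$ (0,0) \<noteq> 0"
  shows "det A = A $$ (0,0) *
    det (mat m m (\<lambda>(i,j). A $$ (Suc i, Suc j) - A $$ (Suc i, 0) * A $$ (0, Suc j) / A $$ (0,0)))"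
    (is "_ = ?a * det ?S")
proof -
  let ?x = "mat m 1 (\<lambda>(i,j). A $$ (Suc i, 0) / ?a)"
  let ?y = "mat 1 m (\<lambda>(i,j). A $$ (0, Suc j))"
  let ?a1 = "mat 1 1 (\<lambda>_. ?a)"
  let ?L = "four_block_mat (1\<^sub>m 1) (0\<^sub>m 1 m) ?x (1\<^sub>m m)"
  let ?U = "four_block_mat ?a1 ?y (0\<^sub>m m 1) ?S"
  have "?L * ?U = four_block_mat (1\<^sub>m 1 * ?a1 + 0\<^sub>m 1 m * 0\<^sub>m m 1) (1\<^sub>m 1 * ?y + 0\<^sub>m 1 m * ?S)
      (?x * ?a1 + 1\<^sub>m m * 0\<^sub>m m 1) (?x * ?y + 1\<^sub>m m * ?S)"
    by (rule mult_four_block_mat) auto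
  also have "\<dots> = four_block_mat ?a1 ?y (?x * ?a1) (?x * ?y + ?S)"
    by (intro cong_four_block_mat) auto
  also have "\<dots> = A"
    by (rule eq_matI) (use A a in \<open>auto simp: scalar_prod_def less_Suc_eq_0_disj\<close>)
  finally have "det A = det (?L * ?U)" by simp
  also have "\<dots> = det ?L * det ?U"
    by (rule det_mult[of _ "1 + m"]) (rule four_block_carrier_mat; simp)+
  also have "det ?L = 1"
    by (subst det_four_block_mat_upper_right_zero[of _ 1 _ m]) auto
  also have "det ?U = ?a * det ?S"
    by (subst det_four_block_mat_lower_left_zero[of _ 1 _ m]) (auto simp: det_single)
  finally show ?thesis by simp
qed

text \<open>
  The corner entry, the rest of the first column, and the Schur complement are free parameters for
  such a matrix: the matrix is recovered from them, and it is nonsingular exactly if the Schur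
  complement is.
\<close>

lemma card_sym_nonzero_corner:
  "card {A \<in> scaled_sym_mats (1 :: 'a :: {field, finite}) (Suc m). A $$ (0,0) \<noteq> 0}
     = (CARD('a) - 1) * CARD('a) ^ m * card (scaled_sym_mats (1 :: 'a) m)"
proof -
  let ?N = "{A \<in> scaled_sym_mats (1 :: 'a) (Suc m). A $$ (0,0) \<noteq> 0}"
  let ?T = "(UNIV - {0 :: 'a}) \<times> (carrier_vec m :: 'a vec set) \<times> scaled_sym_mats (1 :: 'a) m"
  define f where "f = (\<lambda>A :: 'a mat. (A $$ (0,0), vec m (\<lambda>i. A $$ (Suc i, 0)),
      mat m m (\<lambda>(i,j). A $$ (Suc i, Suc j) - A $$ (Suc i, 0) * A $$ (0, Suc j) / A $$ (0,0))))"
  define g where "g = (\<lambda>(a :: 'a, u, D). mat (Suc m) (Suc m) (\<lambda>(i,j).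
      if i = 0 then if j = 0 then a else u $ (j - 1)
      else if j = 0 then u $ (i - 1)
      else D $$ (i - 1, j - 1) + u $ (i - 1) * u $ (j - 1) / a))"
  have fg: "f (g t) = t" if "t \<in> ?T" for t
  proof -
    obtain a u D where t: "t = (a, u, D)" by (cases t)
    have "u \<in> carrier_vec m" "D \<in> carrier_mat m m"
      using that t by (auto simp: scaled_sym_mats_def)
    then show ?thesis unfolding t f_def g_def by (auto intro!: eq_vecI eq_matI)
  qed
  have gf: "g (f A) = A" if "A \<in> ?N" for A
  proof -
    have A: "A \<in> carrier_mat (Suc m) (Suc m)"
      and "\<forall>i<Suc m. \<forall>j<Suc m. A $$ (j,i) = 1 * A $$ (i,j)"
      using that transpose_eq_smult_iff[of A "Suc m" 1] by (auto simp: scaled_sym_mats_def)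
    then have "A $$ (0, Suc i) = A $$ (Suc i, 0)" if "i < m" for i using that by simp
    with A show ?thesis unfolding f_def g_def by (intro eq_matI) (auto simp: less_Suc_eq_0_disj)
  qed
  have fN: "f A \<in> ?T" if "A \<in> ?N" for A
  proof -
    have A: "A \<in> carrier_mat (Suc m) (Suc m)" and d: "det A \<noteq> 0" and a: "A $$ (0,0) \<noteq> 0"
      and s: "\<forall>i<Suc m. \<forall>j<Suc m. A $$ (j,i) = A $$ (i,j)"
      using that transpose_eq_smult_iff[of A "Suc m" 1] by (auto simp: scaled_sym_mats_def)
    from s have s0: "A $$ (0, Suc i) = A $$ (Suc i, 0)"
      and s: "A $$ (Suc j, Suc i) = A $$ (Suc i, Suc j)" if "i < m" "j < m" for i j
      using that by auto
    show ?thesis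
      using d a det_schur_complement[OF A a]
      by (auto simp: scaled_sym_mats_def transpose_eq_smult_iff[of _ m] s0 s f_def mult.commute)
  qed
  have gT: "g t \<in> ?N" if "t \<in> ?T" for t
  proof -
    obtain a u D where t: "t = (a, u, D)" by (cases t)
    have a: "a \<noteq> 0" and u: "u \<in> carrier_vec m" and D: "D \<in> carrier_mat m m"
      and d: "det D \<noteq> 0" and s: "transpose_mat D = 1 \<cdot>\<^sub>m D"
      using that t by (auto simp: scaled_sym_mats_def)
    from s[unfolded transpose_eq_smult_iff[OF D]]
    have s: "D $$ (j,i) = D $$ (i,j)" if "i < m" "j < m" for i j using that by simp
    have c: "g t \<in> carrier_mat (Suc m) (Suc m)" and c0: "g t $$ (0,0) = a" by (auto simp: t g_def)
    have "det (g t) = a * det D"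
      using det_schur_complement[OF c] a c0 fg[OF that] unfolding t by (simp add: f_def)
    moreover have "transpose_mat (g t) = 1 \<cdot>\<^sub>m g t"
      unfolding transpose_eq_smult_iff[OF c]
      by (auto simp: t g_def s less_Suc_eq_0_disj mult.commute)
    ultimately show ?thesis using c c0 a d by (simp add: scaled_sym_mats_def)
  qed
  have "bij_betw f ?N ?T"
    by (rule bij_betw_byWitness[where f' = g]; use fg gf fN gT in blast)
  then have "card ?N = card ?T" by (rule bij_betw_same_card)
  then show ?thesis by (simp add: card_cartesian_product card_carrier_vec card_Diff_singleton)
qed

section \<open>Splitting off a hyperbolic plane\<close>

text \<open>
  Laplace expansion along the first row and then along the first column removes the first two rows
  and columns, whatever their remaining entries are.
\<close>

lemma det_hyperbolic_corner:
  fixes A :: "'a :: field mat"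
  assumes A: "A \<in> carrier_mat (m + 2) (m + 2)"
    and col: "\<And>i. i < m + 2 \<Longrightarrow> A $$ (i,0) = (if i = 1 then b else 0)"
    and row: "\<And>j. j < m + 2 \<Longrightarrow> A $$ (0,j) = (if j = 1 then c else 0)"
  shows "det A = - (b * c) * det (mat m m (\<lambda>(i,j). A $$ (i + 2, j + 2)))"
    (is "_ = _ * det ?D")
proof -
  let ?B = "mat_delete A 0 1"
  have B: "?B \<in> carrier_mat (Suc m) (Suc m)" using A by (auto simp: mat_delete_def)
  have "det A = (\<Sum>j<m+2. A $$ (0,j) * cofactor A 0 j)"
    using laplace_expansion_row[OF A, of 0] by simp
  also have "\<dots> = (\<Sum>j<m+2. if j = 1 then c * cofactor A 0 1 else 0)"
    by (rule sum.cong) (auto simp: row)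
  also have "\<dots> = - c * det ?B" by (simp add: cofactor_def)
  also have "det ?B = (\<Sum>i<Suc m. ?B $$ (i,0) * cofactor ?B i 0)"
    using laplace_expansion_column[OF B, of 0] by simp
  also have "\<dots> = (\<Sum>i<Suc m. if i = 0 then b * cofactor ?B 0 0 else 0)"
    using A by (intro sum.cong) (auto simp: mat_delete_def col)
  also have "\<dots> = b * det (mat_delete ?B 0 0)" by (simp add: cofactor_def)
  also have "mat_delete ?B 0 0 = ?D"
    using A by (intro eq_matI) (auto simp: mat_delete_def)
  finally show ?thesis by simp
qed

text \<open>
  The second diagonal entry, the rest of the second column, and the lower right block are free
  parameters. The diagonal entry $c$ must satisfy $c = e c$, and its number of
  solutions is all that distinguishes the symmetric from the skew-symmetric case here.
\<close>

lemma card_scaled_sym_unit_col: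
  fixes e :: "'a :: {field, finite}"
  assumes e: "e * e = 1"
  shows "card {A \<in> scaled_sym_mats e (m + 2). col A 0 = unit_vec (m + 2) 1}
     = card {c. c = e * c} * CARD('a) ^ m * card (scaled_sym_mats e m)"
proof -
  let ?N = "{A \<in> scaled_sym_mats e (m + 2). col A 0 = unit_vec (m + 2) 1}"
  let ?T = "{c. c = e * c} \<times> (carrier_vec m :: 'a vec set) \<times> scaled_sym_mats e m"
  define f where "f = (\<lambda>A :: 'a mat. (A $$ (1,1), vec m (\<lambda>i. A $$ (i + 2, 1)),
      mat m m (\<lambda>(i,j). A $$ (i + 2, j + 2))))"
  define g where "g = (\<lambda>(c :: 'a, u, D). mat (m + 2) (m + 2) (\<lambda>(i,j).
      if i = 0 then if j = 1 then e else 0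
      else if j = 0 then if i = 1 then 1 else 0
      else if i = 1 then if j = 1 then c else e * u $ (j - 2)
      else if j = 1 then u $ (i - 2) else D $$ (i - 2, j - 2)))"
  have e0: "e \<noteq> 0" using e by auto
  have less2: "i < m + 2 \<longleftrightarrow> i = 0 \<or> i = 1 \<or> (\<exists>k<m. i = k + 2)" for i
    by (auto simp: less_Suc_eq_0_disj)
  have N: "A \<in> carrier_mat (m + 2) (m + 2)" "det A \<noteq> 0"
    "i < m + 2 \<Longrightarrow> j < m + 2 \<Longrightarrow> A $$ (j,i) = e * A $$ (i,j)"
    "i < m + 2 \<Longrightarrow> A $$ (i,0) = (if i = 1 then 1 else 0)"
    "i < m + 2 \<Longrightarrow> A $$ (0,i) = (if i = 1 then e else 0)"
    if "A \<in> ?N" for A i j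
  proof -
    show A: "A \<in> carrier_mat (m + 2) (m + 2)" and "det A \<noteq> 0"
      using that by (auto simp: scaled_sym_mats_def)
    have "transpose_mat A = e \<cdot>\<^sub>m A" using that by (auto simp: scaled_sym_mats_def)
    then show s: "i < m + 2 \<Longrightarrow> j < m + 2 \<Longrightarrow> A $$ (j,i) = e * A $$ (i,j)" for i j
      unfolding transpose_eq_smult_iff[OF A] by blast
    have "col A 0 = unit_vec (m + 2) 1" using that by simp
    from arg_cong[OF this, of "\<lambda>v. v $ i"] A
    show c: "i < m + 2 \<Longrightarrow> A $$ (i,0) = (if i = 1 then 1 else 0)" by (auto simp: unit_vec_def)
    show "i < m + 2 \<Longrightarrow> A $$ (0,i) = (if i = 1 then e else 0)" using c s[of i 0] by simp
  qed
  have fg: "f (g t) = t" if "t \<in> ?T" for t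
  proof -
    obtain c u D where t: "t = (c, u, D)" by (cases t)
    have "u \<in> carrier_vec m" "D \<in> carrier_mat m m"
      using that t by (auto simp: scaled_sym_mats_def)
    then show ?thesis unfolding t f_def g_def by (auto intro!: eq_vecI eq_matI)
  qed
  have gf: "g (f A) = A" if "A \<in> ?N" for A
  proof (rule eq_matI)
    fix i j assume "i < dim_row A" "j < dim_col A"
    then have ij: "i < m + 2" "j < m + 2" using N(1)[OF that] by auto
    have "A $$ (1, k + 2) = e * A $$ (k + 2, 1)" if "k < m" for k
      using N(3)[OF \<open>A \<in> ?N\<close>, of "k + 2" 1] that by simp
    then show "g (f A) $$ (i,j) = A $$ (i,j)"
      using ij[unfolded less2] N(4)[OF that ij(1)] N(5)[OF that ij(2)]
      unfolding f_def g_def by (elim disjE exE conjE) simp_all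
  qed (use N(1)[OF that] in \<open>auto simp: f_def g_def\<close>)
  have fN: "f A \<in> ?T" if "A \<in> ?N" for A
  proof -
    have "det A = - (1 * e) * det (mat m m (\<lambda>(i,j). A $$ (i + 2, j + 2)))"
      by (rule det_hyperbolic_corner) (use N(1,4,5)[OF that] in auto)
    with N(2)[OF that] have "det (mat m m (\<lambda>(i,j). A $$ (i + 2, j + 2))) \<noteq> 0" by auto
    moreover have "transpose_mat (mat m m (\<lambda>(i,j). A $$ (i + 2, j + 2)))
        = e \<cdot>\<^sub>m mat m m (\<lambda>(i,j). A $$ (i + 2, j + 2))"
      by (rule eq_matI) (simp_all, rule N(3)[OF that], auto)
    moreover have "A $$ (1,1) = e * A $$ (1,1)" by (rule N(3)[OF that]) auto
    ultimately show ?thesis unfolding f_def scaled_sym_mats_def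
      by (intro SigmaI CollectI conjI mat_carrier vec_carrier)
  qed
  have gT: "g t \<in> ?N" if "t \<in> ?T" for t
  proof -
    obtain c u D where t: "t = (c, u, D)" by (cases t)
    have c: "e * c = c" and u: "u \<in> carrier_vec m" and D: "D \<in> carrier_mat m m"
      and d: "det D \<noteq> 0" and s: "transpose_mat D = e \<cdot>\<^sub>m D"
      using that t by (auto simp: scaled_sym_mats_def)
    from s[unfolded transpose_eq_smult_iff[OF D]]
    have s: "D $$ (j,i) = e * D $$ (i,j)" if "i < m" "j < m" for i j using that by blast
    have gc: "g t \<in> carrier_mat (m + 2) (m + 2)" by (auto simp: t g_def)
    have "det (g t) = - (1 * e) * det (mat m m (\<lambda>(i,j). g t $$ (i + 2, j + 2)))"
      by (rule det_hyperbolic_corner[OF gc]) (auto simp: t g_def)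
    also have "mat m m (\<lambda>(i,j). g t $$ (i + 2, j + 2)) = D"
      using fg[OF that] unfolding t f_def by simp
    finally have "det (g t) \<noteq> 0" using d e0 by simp
    moreover have ee: "e * (e * x) = x" for x using e by (metis mult.assoc mult_1)
    have "g t $$ (j,i) = e * g t $$ (i,j)" if "i < m + 2" "j < m + 2" for i j
      using that[unfolded less2] unfolding t g_def
      by (elim disjE exE conjE) (simp_all add: c e ee, rule s)
    then have "transpose_mat (g t) = e \<cdot>\<^sub>m g t"
      unfolding transpose_eq_smult_iff[OF gc] by blast
    moreover have "col (g t) 0 = unit_vec (m + 2) 1"
      by (intro eq_vecI) (auto simp: t g_def unit_vec_def)
    ultimately show ?thesis using gc by (simp add: scaled_sym_mats_def)
  qed
  have "bij_betw f ?N ?T"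
    by (rule bij_betw_byWitness[where f' = g]; use fg gf fN gT in blast)
  then have "card ?N = card ?T" by (rule bij_betw_same_card)
  then show ?thesis by (simp add: card_cartesian_product card_carrier_vec)
qed

section \<open>Moving the first column by congruence\<close>

lemma mult_mat_unit_vec:
  fixes A :: "'a :: semiring_1 mat"
  assumes "A \<in> carrier_mat k n" and "j < n"
  shows "A *\<^sub>v unit_vec n j = col A j"
  using assms by (intro eq_vecI) auto

lemma congruence_scaled_sym_mats:
  assumes A: "A \<in> scaled_sym_mats e n" and P: "P \<in> carrier_mat n n" and d: "det P \<noteq> 0"
  shows "P * A * transpose_mat P \<in> scaled_sym_mats e n"
proof -
  have c: "A \<in> carrier_mat n n" and s: "transpose_mat A = e \<cdot>\<^sub>m A" and dA: "det A \<noteq> 0"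
    using A by (auto simp: scaled_sym_mats_def)
  have PA: "P * A \<in> carrier_mat n n" and Pt: "transpose_mat P \<in> carrier_mat n n"
    and At: "transpose_mat A \<in> carrier_mat n n" using P c by auto
  have det: "det (P * A * transpose_mat P) = det P * det A * det P"
    using det_mult[OF PA Pt] det_mult[OF P c] det_transpose[OF P] by simp
  have "transpose_mat (P * A * transpose_mat P) = P * (transpose_mat A * transpose_mat P)"
    using transpose_mult[OF PA Pt] transpose_mult[OF P c] by simp
  also have "\<dots> = P * transpose_mat A * transpose_mat P"
    using assoc_mult_mat[OF P At Pt] by simp
  also have "\<dots> = e \<cdot>\<^sub>m (P * A * transpose_mat P)"
    unfolding s mult_smult_distrib[OF P c] mult_smult_assoc_mat[OF PA Pt] ..
  finally show ?thesis using det d dA PA Pt by (auto simp: scaled_sym_mats_def)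
qed

text \<open>
  Since row $j$ of $P$ is a unit vector, the right factor $P^T$ leaves column $j$ alone, and only
  the left factor acts on it.
\<close>

lemma col_congruence:
  fixes A P :: "'a :: comm_ring_1 mat"
  assumes A: "A \<in> carrier_mat n n" and P: "P \<in> carrier_mat n n" and n: "j < n"
    and r: "row P j = unit_vec n j"
  shows "col (P * A * transpose_mat P) j = P *\<^sub>v col A j"
proof -
  have "col (P * A * transpose_mat P) j = (P * A) *\<^sub>v row P j"
    using P A n by (subst col_mult2[of _ n n _ n]) auto
  also have "\<dots> = P *\<^sub>v (A *\<^sub>v unit_vec n j)"
    unfolding r using P A by (intro assoc_mult_mat_vec) auto
  finally show ?thesis using mult_mat_unit_vec[OF A n] by simp
qed

text \<open>
  Congruence by $P$ is a bijection between the two sets; its inverse is congruence by the inverse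
  matrix, which has the same unit row.
\<close>

lemma card_fixed_col_congruence:
  fixes P :: "'a :: {field, finite} mat"
  assumes P: "P \<in> carrier_mat n n" and d: "det P \<noteq> 0" and n: "j < n"
    and r: "row P j = unit_vec n j" and u: "u \<in> carrier_vec n"
  shows "card {A \<in> scaled_sym_mats e n. col A j = u}
    = card {A \<in> scaled_sym_mats e n. col A j = P *\<^sub>v u}"
proof -
  from det_nonzero_obtains_inverse[OF P d] obtain Q
    where Q: "Q \<in> carrier_mat n n" and PQ: "P * Q = 1\<^sub>m n" and QP: "Q * P = 1\<^sub>m n" by blast
  have "det P * det Q = 1" using det_mult[OF P Q] PQ by simp
  then have dQ: "det Q \<noteq> 0" by auto
  \<comment> \<open>Row \<open>j\<close> of \<open>Q\<close> is row \<open>j\<close> of \<open>P\<close> times \<open>Q\<close>, hence row \<open>j\<close> of the identity.\<close>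
  have rQ: "row Q j = unit_vec n j"
  proof (rule eq_vecI)
    fix i assume "i < dim_vec (unit_vec n j :: 'a vec)"
    then have i: "i < n" by simp
    have "row Q j $ i = row P j \<bullet> col Q i" unfolding r using i n Q by simp
    also have "\<dots> = (P * Q) $$ (j,i)" using i n P Q by simp
    finally show "row Q j $ i = unit_vec n j $ i" unfolding PQ using i n by (simp add: unit_vec_def)
  qed (use Q in auto)
  have cancel: "Y * (X * A * transpose_mat X) * transpose_mat Y = A"
    if "A \<in> carrier_mat n n" "X \<in> carrier_mat n n" "Y \<in> carrier_mat n n" "Y * X = 1\<^sub>m n"
    for A X Y :: "'a mat"
  proof -
    have t: "transpose_mat X * transpose_mat Y = 1\<^sub>m n"
      using transpose_mult[OF that(3,2)] that(4) by simp
    have "Y * (X * A * transpose_mat X) * transpose_mat Y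
        = Y * X * A * (transpose_mat X * transpose_mat Y)"
      using that(1-3) by (simp add: assoc_mult_mat[of _ n n _ n _ n])
    then show ?thesis unfolding t that(4) using that(1) by simp
  qed
  have "Q *\<^sub>v (P *\<^sub>v u) = u"
    using assoc_mult_mat_vec[OF Q P u] QP u by simp
  moreover have c: "A \<in> carrier_mat n n" if "A \<in> scaled_sym_mats e n" for A :: "'a mat" and e
    using that by (simp add: scaled_sym_mats_def)
  ultimately have "bij_betw (\<lambda>A. P * A * transpose_mat P)
      {A \<in> scaled_sym_mats e n. col A j = u} {A \<in> scaled_sym_mats e n. col A j = P *\<^sub>v u}"
    by (intro bij_betw_byWitness[where f' = "\<lambda>A. Q * A * transpose_mat Q"])
      (auto simp: cancel P Q PQ QP col_congruence[OF _ P n r] col_congruence[OF _ Q n rQ]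
        intro: congruence_scaled_sym_mats[OF _ P d] congruence_scaled_sym_mats[OF _ Q dQ])
  then show ?thesis by (rule bij_betw_same_card)
qed

text \<open>
  This provides a congruence that keeps the first coordinate and takes the second unit vector to a
  prescribed vector $v$. Choose $k$ with $v_k \<noteq> 0$, put $v$ into column $1$ of the identity matrix,
  and use the displaced unit vector as column $k$. The hypothesis on $v_0$ makes the first row a unit
  vector.
\<close>

lemma exists_pivot_mat:
  fixes v :: "'a :: field vec"
  assumes v: "v \<in> carrier_vec n" and v0: "v $ 0 = 0" and nz: "v \<noteq> 0\<^sub>v n"
  shows "\<exists>P \<in> carrier_mat n n. det P \<noteq> 0 \<and> row P 0 = unit_vec n 0 \<and> col P 1 = v"
proof -
  from nz v obtain k where k: "k < n" "v $ k \<noteq> 0" by (auto simp: vec_eq_iff)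
  with v0 have k0: "k \<noteq> 0" by metis
  with k have n: "1 < n" by auto
  define t where "t j = (if j = k then 1 else j)" for j
  define P where "P = mat n n (\<lambda>(i,j). if j = 1 then v $ i else if i = t j then 1 else 0)"
  have P: "P \<in> carrier_mat n n" by (simp add: P_def)
  have Pw: "(P *\<^sub>v w) $ i = (\<Sum>j\<in>{0..<n}. (if j = 1 then v $ i else if i = t j then 1 else 0) * w $ j)"
    if "i < n" "w \<in> carrier_vec n" for w i
    using that by (auto simp: P_def scalar_prod_def intro!: sum.cong)
  have "w = 0\<^sub>v n" if w: "w \<in> carrier_vec n" and eq: "P *\<^sub>v w = 0\<^sub>v n" for w
  proof -
    \<comment> \<open>Only column \<open>1\<close> has a nonzero entry in row \<open>k\<close>, which forces \<open>w $ 1 = 0\<close>.\<close>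
    have "0 = (\<Sum>j\<in>{0..<n}. (if j = 1 then v $ k else if k = t j then 1 else 0) * w $ j)"
      using Pw[OF k(1) w] eq k(1) by simp
    also have "\<dots> = (\<Sum>j\<in>{0..<n}. if j = 1 then v $ k * w $ 1 else 0)"
      by (rule sum.cong) (auto simp: t_def)
    also have "\<dots> = v $ k * w $ 1" using n by simp
    finally have w1: "w $ 1 = 0" using k(2) by simp
    \<comment> \<open>After that, row \<open>t j\<close> isolates the coordinate \<open>w $ j\<close>.\<close>
    have "w $ j = 0" if "j < n" "j \<noteq> 1" for j
    proof -
      have tj: "t j < n" using that n by (simp add: t_def)
      have "0 = (\<Sum>i\<in>{0..<n}. (if i = 1 then v $ t j else if t j = t i then 1 else 0) * w $ i)"
        using Pw[OF tj w] eq tj by simp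
      also have "\<dots> = (\<Sum>i\<in>{0..<n}. if i = j then w $ j else 0)"
        using w1 that by (intro sum.cong) (auto simp: t_def split: if_splits)
      also have "\<dots> = w $ j" using that by simp
      finally show ?thesis by simp
    qed
    then have "w $ j = 0" if "j < n" for j using w1 that by (cases "j = 1") auto
    then show ?thesis using w by (intro eq_vecI) auto
  qed
  then have "det P \<noteq> 0" using det_0_iff_vec_prod_zero_field[OF P] by blast
  moreover have "row P 0 = unit_vec n 0"
    using n v0 k0 by (intro eq_vecI) (auto simp: P_def t_def unit_vec_def)
  moreover have "col P 1 = v" using n v by (intro eq_vecI) (auto simp: P_def)
  ultimately show ?thesis using P by blast
qed

text \<open>
  Sort the matrices by their first column. It is nonzero because the matrix is nonsingular, its first
  entry is zero, and every such column occurs equally often, by congruence with the case of the second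
  unit vector.
\<close>

lemma card_scaled_sym_zero_corner:
  fixes e :: "'a :: {field, finite}"
  assumes e: "e * e = 1"
  shows "card {A \<in> scaled_sym_mats e (m + 2). A $$ (0,0) = 0}
     = (CARD('a) ^ (m + 1) - 1) *
       (card {c. c = e * c} * CARD('a) ^ m * card (scaled_sym_mats e m))"
proof -
  let ?n = "m + 2"
  let ?N = "\<lambda>v. {A \<in> scaled_sym_mats e ?n. col A 0 = v}"
  \<comment> \<open>The admissible first columns; prepending the zero entry makes them easy to count.\<close>
  define V where "V = vCons (0 :: 'a) ` (carrier_vec (m + 1) - {0\<^sub>v (m + 1)})"
  have V: "v \<in> V \<longleftrightarrow> v \<in> carrier_vec ?n \<and> v $ 0 = 0 \<and> v \<noteq> 0\<^sub>v ?n" for v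
    by (cases v) (auto simp: V_def zero_vec_Suc dest: arg_cong[of _ _ dim_vec])
  have finV: "finite V" by (simp add: V_def)
  have cardV: "card V = CARD('a) ^ (m + 1) - 1"
    unfolding V_def by (subst card_image)
      (auto simp: inj_on_def card_Diff_singleton card_carrier_vec simp del: power_Suc)
  have "A \<in> {A \<in> scaled_sym_mats e ?n. A $$ (0,0) = 0} \<longleftrightarrow> A \<in> (\<Union>v\<in>V. ?N v)" for A
  proof (cases "A \<in> scaled_sym_mats e ?n")
    case True
    then have A: "A \<in> carrier_mat ?n ?n" and d: "det A \<noteq> 0"
      by (auto simp: scaled_sym_mats_def)
    have "col A 0 \<noteq> 0\<^sub>v ?n"
    proof
      assume "col A 0 = 0\<^sub>v ?n"
      then have "A *\<^sub>v unit_vec ?n 0 = 0\<^sub>v ?n" using mult_mat_unit_vec[OF A, of 0] by simp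
      moreover have "unit_vec ?n 0 \<noteq> (0\<^sub>v ?n :: 'a vec)" by (auto simp: vec_eq_iff unit_vec_def)
      ultimately show False
        using d det_0_iff_vec_prod_zero_field[OF A] unit_vec_carrier[of ?n 0] by blast
    qed
    then show ?thesis using True A col_dim[of A 0] by (auto simp: V intro: carrier_vecI)
  qed auto
  then have "{A \<in> scaled_sym_mats e ?n. A $$ (0,0) = 0} = (\<Union>v\<in>V. ?N v)" by blast
  then have "card {A \<in> scaled_sym_mats e ?n. A $$ (0,0) = 0} = (\<Sum>v\<in>V. card (?N v))"
    using card_UN_disjoint[OF finV, of ?N] finite_subset[OF _ finite_scaled_sym_mats[of e ?n]]
    by auto
  also have "card (?N v) = card {c. c = e * c} * CARD('a) ^ m * card (scaled_sym_mats e m)"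
    if "v \<in> V" for v
  proof -
    from that exists_pivot_mat[of v ?n] obtain P where P: "P \<in> carrier_mat ?n ?n" "det P \<noteq> 0"
      "row P 0 = unit_vec ?n 0" "col P 1 = v" unfolding V by blast
    then have "card (?N (unit_vec ?n 1)) = card (?N v)"
      using card_fixed_col_congruence[OF P(1,2) _ P(3), of "unit_vec ?n 1" e]
        mult_mat_unit_vec[OF P(1), of 1] by simp
    then show ?thesis using card_scaled_sym_unit_col[OF e, of m] by simp
  qed
  then have "(\<Sum>v\<in>V. card (?N v))
      = card V * (card {c. c = e * c} * CARD('a) ^ m * card (scaled_sym_mats e m))"
    by simp
  finally show ?thesis by (simp only: cardV)
qed

section \<open>The two recursions\<close>

lemma card_scaled_sym_mats_0: "card (scaled_sym_mats (e :: 'a :: field) 0) = 1"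
proof -
  have "scaled_sym_mats e 0 = {0\<^sub>m 0 0}"
    by (auto simp: scaled_sym_mats_def intro!: eq_matI)
  then show ?thesis by simp
qed

lemma card_sym_1: "card (scaled_sym_mats (1 :: 'a :: {field, finite}) 1) = CARD('a) - 1"
proof -
  have "scaled_sym_mats (1 :: 'a) 1 = {A \<in> scaled_sym_mats 1 (Suc 0). A $$ (0,0) \<noteq> 0}"
    by (auto simp: scaled_sym_mats_def det_single)
  then show ?thesis using card_sym_nonzero_corner[where ?'a = 'a, of 0]
    by (simp add: card_scaled_sym_mats_0)
qed

text \<open>
  The two summands count the matrices with nonzero and with zero corner entry. In the second one the
  equation $c = 1 \<cdot> c$ on the diagonal entry contributes a factor $q$.
\<close>

lemma card_sym_rec:
  "card (scaled_sym_mats (1 :: 'a :: {field, finite}) (m + 2))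
     = (CARD('a) - 1) * CARD('a) ^ (m + 1) * card (scaled_sym_mats (1 :: 'a) (m + 1))
     + (CARD('a) ^ (m + 1) - 1) * CARD('a) ^ (m + 1) * card (scaled_sym_mats (1 :: 'a) m)"
proof -
  let ?S = "scaled_sym_mats (1 :: 'a) (m + 2)"
  have "?S = {A \<in> ?S. A $$ (0,0) \<noteq> 0} \<union> {A \<in> ?S. A $$ (0,0) = 0}" by blast
  then have "card ?S = card {A \<in> ?S. A $$ (0,0) \<noteq> 0} + card {A \<in> ?S. A $$ (0,0) = 0}"
    using finite_scaled_sym_mats[of "1 :: 'a" "m + 2"]
    by (metis (no_types, lifting) card_Un_disjoint disjoint_iff finite_Un mem_Collect_eq)
  then show ?thesis
    using card_sym_nonzero_corner[where ?'a = 'a, of "m + 1"]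
      card_scaled_sym_zero_corner[of "1 :: 'a" m] by simp
qed

lemma two_neq_zero_if_odd_card:
  assumes "odd CARD('a :: {field, finite})"
  shows "(2 :: 'a) \<noteq> 0"
proof
  assume "(2 :: 'a) = 0"
  then have "CHAR('a) dvd 2" using of_nat_eq_0_iff_char_dvd[where ?'a = 'a, of 2] by simp
  then have "CHAR('a) = 2"
    using CHAR_not_1[where ?'a = 'a] by (metis One_nat_def prime_nat_iff two_is_prime_nat)
  with CHAR_dvd_CARD[where ?'a = 'a] assms show False by simp
qed

text \<open>
  Because $2 \<noteq> 0$, the equation $c = -c$ has only the solution zero; so the corner entry always
  vanishes, and the second diagonal entry contributes only a factor $1$.
\<close>

lemma card_skew_rec:
  assumes "(2 :: 'a :: {field, finite}) \<noteq> 0"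
  shows "card (scaled_sym_mats (- 1 :: 'a) (m + 2))
     = (CARD('a) ^ (m + 1) - 1) * CARD('a) ^ m * card (scaled_sym_mats (- 1 :: 'a) m)"
proof -
  have neg: "c = - 1 * c \<longleftrightarrow> c = 0" for c :: 'a
    using assms by (metis add.right_inverse mult_2 mult_eq_0_iff mult_minus1 neg_equal_0_iff_equal)
  have "A $$ (0,0) = 0" if "A \<in> scaled_sym_mats (- 1 :: 'a) (m + 2)" for A
  proof -
    have A: "A \<in> carrier_mat (m + 2) (m + 2)" and s: "transpose_mat A = - 1 \<cdot>\<^sub>m A"
      using that by (auto simp: scaled_sym_mats_def)
    have "A $$ (0,0) = - 1 * A $$ (0,0)"
      by (rule s[unfolded transpose_eq_smult_iff[OF A], rule_format]) simp_all
    then show ?thesis unfolding neg .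
  qed
  then have "scaled_sym_mats (- 1 :: 'a) (m + 2)
      = {A \<in> scaled_sym_mats (- 1 :: 'a) (m + 2). A $$ (0,0) = 0}" by blast
  then have "card (scaled_sym_mats (- 1 :: 'a) (m + 2))
      = card {A \<in> scaled_sym_mats (- 1 :: 'a) (m + 2). A $$ (0,0) = 0}"
    by (rule arg_cong[where f = card])
  also have "\<dots> = (CARD('a) ^ (m + 1) - 1) *
       (card {c :: 'a. c = - 1 * c} * CARD('a) ^ m * card (scaled_sym_mats (- 1 :: 'a) m))"
    by (rule card_scaled_sym_zero_corner) simp
  also have "{c :: 'a. c = - 1 * c} = {0}" unfolding neg by simp
  finally show ?thesis by simp
qed

text \<open>
  The induction needs the relation $s(2k+1) = (q^{2k+1}-1) s(2k)$ as well: it turns the second-order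
  recursion of $s$ into a first-order one. Integers avoid truncated subtraction in $q^i - 1$.
\<close>

lemma sym_skew_recursions_agree:
  fixes q :: int and s a :: "nat \<Rightarrow> int"
  assumes s0: "s 0 = 1" and s1: "s 1 = q - 1" and a0: "a 0 = 1"
    and s: "\<And>m. s (m + 2) = (q - 1) * q ^ (m + 1) * s (m + 1) + (q ^ (m + 1) - 1) * q ^ (m + 1) * s m"
    and a: "\<And>m. a (m + 2) = (q ^ (m + 1) - 1) * q ^ m * a m"
  shows "a (2 * k + 2) = s (2 * k + 1)"
proof -
  have "s (2 * k + 1) = (q ^ (2 * k + 1) - 1) * s (2 * k) \<and> a (2 * k + 2) = s (2 * k + 1)"
  proof (induction k)
    case 0
    then show ?case using a[of 0] s1 by (simp add: s0 a0)
  next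
    case (Suc k)
    define p where "p = q ^ (2 * k)"
    have p: "q ^ (2 * k + 1) = q * p" "q ^ (2 * k + 2) = q * q * p" "q ^ (2 * k + 3) = q * q * q * p"
      by (simp_all add: p_def power_add power2_eq_square power3_eq_cube)
    have idx: "2 * k + 1 + 2 = 2 * k + 3" "2 * k + 1 + 1 = 2 * k + 2"
      "2 * k + 2 + 2 = 2 * k + 4" "2 * k + 2 + 1 = 2 * k + 3" by simp_all
    have e1: "s (2 * k + 2) = q * q * p * s (2 * k + 1)"
    proof -
      have "s (2 * k + 2) = (q - 1) * (q * p) * s (2 * k + 1) + (q * p) * ((q * p - 1) * s (2 * k))"
        using s[of "2 * k", unfolded p] by (simp only: mult.left_commute mult.assoc)
      also have "(q * p - 1) * s (2 * k) = s (2 * k + 1)" using Suc unfolding p by simp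
      finally show ?thesis by (simp add: algebra_simps)
    qed
    have e2: "s (2 * k + 3) = (q * q * q * p - 1) * s (2 * k + 2)"
    proof -
      have "s (2 * k + 3) = (q - 1) * (q * q * p) * s (2 * k + 2)
          + (q * q * p - 1) * (q * q * p * s (2 * k + 1))"
        using s[of "2 * k + 1", unfolded idx p] by (simp only: mult.assoc)
      then show ?thesis unfolding e1[symmetric] by (simp add: algebra_simps)
    qed
    have e3: "a (2 * k + 4) = (q * q * q * p - 1) * (q * q * p) * a (2 * k + 2)"
      using a[of "2 * k + 2", unfolded idx p] .
    have "s (2 * k + 3) = (q ^ (2 * k + 3) - 1) * s (2 * k + 2)" using e2 unfolding p .
    moreover have "a (2 * k + 4) = s (2 * k + 3)" using e1 e2 e3 Suc by simp
    moreover have "2 * Suc k + 1 = 2 * k + 3" "2 * Suc k + 2 = 2 * k + 4" "2 * Suc k = 2 * k + 2"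
      by simp_all
    ultimately show ?case by metis
  qed
  then show ?thesis ..
qed

theorem proposition3p6:
  fixes q n :: nat
  assumes "primepow q" and "odd q"
    and "CARD('a :: {field, finite}) = q"
    and "even n" and "n > 0"
  shows "card {A \<in> carrier_mat n n. invertible_mat A \<and> skew_symmetric_mat (A :: 'a mat)}
       = card {A \<in> carrier_mat (n - 1) (n - 1). invertible_mat A \<and> symmetric_mat (A :: 'a mat)}"
proof -
  have minus: "- 1 \<cdot>\<^sub>m A = - A" and one: "1 \<cdot>\<^sub>m A = A" for A :: "'a mat"
    by (auto intro!: eq_matI)
  have skew: "{A \<in> carrier_mat k k. invertible_mat A \<and> skew_symmetric_mat (A :: 'a mat)}
      = scaled_sym_mats (- 1) k" for k
    by (auto simp: scaled_sym_mats_def invertible_mat_iff_det skew_symmetric_mat_def minus)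
  have sym: "{A \<in> carrier_mat k k. invertible_mat A \<and> symmetric_mat (A :: 'a mat)}
      = scaled_sym_mats 1 k" for k
    by (auto simp: scaled_sym_mats_def invertible_mat_iff_det symmetric_mat_def one)
  from \<open>even n\<close> \<open>n > 0\<close> obtain k where n: "n = 2 * k + 2"
    by (metis add.commute add_2_eq_Suc' evenE gr0_implies_Suc mult_Suc_right mult_0_right not_gr0)
  have two: "(2 :: 'a) \<noteq> 0" using two_neq_zero_if_odd_card[where ?'a = 'a] assms by simp
  have int_pred: "int (CARD('a) ^ i - 1) = int CARD('a) ^ i - 1" for i
    by (simp add: of_nat_diff)
  have "int (card (scaled_sym_mats (- 1 :: 'a) (2 * k + 2)))
      = int (card (scaled_sym_mats (1 :: 'a) (2 * k + 1)))"
  proof (rule sym_skew_recursions_agree[where q = "int CARD('a)"])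
    show "int (card (scaled_sym_mats (1 :: 'a) 1)) = int CARD('a) - 1"
      unfolding card_sym_1 using int_pred[of 1] by simp
    show "int (card (scaled_sym_mats (1 :: 'a) (m + 2)))
      = (int CARD('a) - 1) * int CARD('a) ^ (m + 1) * int (card (scaled_sym_mats (1 :: 'a) (m + 1)))
      + (int CARD('a) ^ (m + 1) - 1) * int CARD('a) ^ (m + 1) * int (card (scaled_sym_mats (1 :: 'a) m))"
      for m
      unfolding card_sym_rec of_nat_add of_nat_mult int_pred of_nat_power
      using int_pred[of 1] by simp
    show "int (card (scaled_sym_mats (- 1 :: 'a) (m + 2)))
      = (int CARD('a) ^ (m + 1) - 1) * int CARD('a) ^ m * int (card (scaled_sym_mats (- 1 :: 'a) m))"
      for m
      unfolding card_skew_rec[OF two] of_nat_mult int_pred of_nat_power ..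
  qed (simp_all add: card_scaled_sym_mats_0)
  then show ?thesis unfolding skew sym n by simp
qed

end
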